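(* Let $n \geq 1$. Start from the configuration with chips $(1),(2),\ldots,(n)$ all at vertex $0$ of $\mathbb{Z}$, and repeatedly apply any of the following moves, in any order, for as long as some move is possible: (I) if chips $(a)$ and $(b)$ with $a<b$ are both at some vertex $i \in \mathbb{Z}$, move $(a)$ to $i-1$ and $(b)$ to $i+1$; (II) if chip $(a)$ is at vertex $i\in\mathbb{Z}$ and chip $(b)$ is at vertex $-i$ (with $a\neq b$), move both $(a)$ and $(b)$ rightward one vertex; (III) if chip $(a)$ is at vertex $0$, move $(a)$ to vertex $1$. Then the process always terminates, and it always terminates at the configuration in which chip $(i)$ is at vertex $i$ for every $1 \leq i \leq n$.
   Context: Chips are labeled by positive integers and placed on the vertices of $\mathbb{Z}$; a vertex may hold several chips. *)

theory Defs imports Main begin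

text \<open>
  A configuration is given by the positions of the labeled chips. Only the values at the
  labels \<open>1, \<dots>, n\<close> are meaningful: the moves act on these chips alone.
\<close>

type_synonym config = "nat \<Rightarrow> int"

definition initial_config :: config where
  "initial_config = (\<lambda>_. 0)"

text \<open>
  In \<open>move_II\<close>, \<open>c a = 0\<close> is allowed: two distinct chips at the origin may both move to vertex \<open>1\<close>.
\<close>

inductive move :: "nat \<Rightarrow> config \<Rightarrow> config \<Rightarrow> bool" for n :: nat where
  move_I: "a \<in> {1..n} \<Longrightarrow> b \<in> {1..n} \<Longrightarrow> a < b \<Longrightarrow> c a = c b \<Longrightarrow>
    move n c (c(a := c a - 1, b := c b + 1))"
| move_II: "a \<in> {1..n} \<Longrightarrow> b \<in> {1..n} \<Longrightarrow> a \<noteq> b \<Longrightarrow> c b = - c a \<Longrightarrow>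
    move n c (c(a := c a + 1, b := c b + 1))"
| move_III: "a \<in> {1..n} \<Longrightarrow> c a = 0 \<Longrightarrow> move n c (c(a := 1))"

definition terminal :: "nat \<Rightarrow> config \<Rightarrow> bool" where
  "terminal n c \<longleftrightarrow> (\<nexists>c'. move n c c')"

end

theory Submission imports Defs begin

text \<open>
  Replacing every chip \<open>(a)\<close> at \<open>i\<close> by chips \<open>(a)\<close> at \<open>i\<close> and \<open>(-a)\<close> at \<open>-i\<close> turns each move into
  one or two ordinary labeled firings (the smaller chip goes left, the larger one right), so the
  theorem reduces to sorting \<open>2m\<close> chips that start at the origin. Forgetting labels, site \<open>i\<close> fires
  \<open>h(h + 1)/2\<close> times in total with \<open>h = m - \<bar>i\<bar>\<close>. Let \<open>v\<close> count the firings still to come. An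
  interval of sites that have all fired holds at least one chip per internal edge, because of two
  neighbours the one that fired last has since given a chip to the other. This forces the last
  \<open>m - \<bar>i\<bar>\<close> firings at the sites \<open>i\<close> to interlace, each of them emptying its site. Firings that empty their
  site act on the number \<open>A i\<close> of chips at or right of \<open>i\<close> among the \<open>k\<close> smallest chips by the rule
  \<open>A i, A (i + 1) := max (A i - 1) (A (i + 1))\<close>, which preserves the bound
  \<open>A i \<le> max 0 (k - m + min (v i + max 0 (- i)) (m - max 0 i))\<close>. When \<open>v = 0\<close> and \<open>k \<le> m\<close>, the
  choice \<open>i = k - m\<close> gives \<open>A i = 0\<close>, that is, the \<open>k\<close> smallest chips lie left of \<open>k - m\<close>.
\<close>

section \<open>Odometers of unlabeled firing and the total number of firings\<close>

text \<open>
  An odometer \<open>w\<close> records how often each site has fired, starting from \<open>2m\<close> unlabeled chips at \<open>0\<close>.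
\<close>

definition chips :: "int \<Rightarrow> (int \<Rightarrow> int) \<Rightarrow> int \<Rightarrow> int" where
  "chips m w i = (if i = 0 then 2 * m else 0) + w (i - 1) + w (i + 1) - 2 * w i"

inductive legal :: "int \<Rightarrow> (int \<Rightarrow> int) \<Rightarrow> bool" for m :: int where
  legal_zero: "legal m (\<lambda>_. 0)"
| legal_fire: "legal m w \<Longrightarrow> chips m w x \<ge> 2 \<Longrightarrow> legal m (w(x := w x + 1))"

definition total :: "int \<Rightarrow> int \<Rightarrow> int" where
  "total m i = (let h = max 0 (m - \<bar>i\<bar>) in h * (h + 1) div 2)"

text \<open>This is the \<open>v\<close> of the overview. Subtraction is over the integers, so
  nonnegativity is a genuine fact, supplied by \<open>legal_remaining_nonneg\<close>.\<close>

definition remaining :: "int \<Rightarrow> (int \<Rightarrow> int) \<Rightarrow> int \<Rightarrow> int" where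
  "remaining m w i = total m i - w i"

lemma total_diff:
  assumes "0 \<le> i" "i < m"
  shows "total m i - total m (i + 1) = m - i"
proof -
  have "(m - i) * (m - i + 1) = (m - (i + 1)) * (m - (i + 1) + 1) + (m - i) * 2"
    by (simp add: algebra_simps)
  then have "(m - i) * (m - i + 1) div 2 = (m - (i + 1)) * (m - (i + 1) + 1) div 2 + (m - i)"
    by simp
  then show ?thesis
    using assms by (simp add: total_def max_def Let_def)
qed

lemma total_uminus [simp]: "total m (- i) = total m i"
  by (simp add: total_def)

lemma total_outside: "\<bar>i\<bar> \<ge> m \<Longrightarrow> total m i = 0"
  by (simp add: total_def max_def)

lemma total_nonneg: "0 \<le> total m i"
  by (auto simp: total_def Let_def intro!: pos_imp_zdiv_nonneg_iff[THEN iffD2] mult_nonneg_nonneg)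

text \<open>The odometer \<open>total m\<close> turns \<open>2 * m\<close> chips at \<open>0\<close>
  into one chip on each nonzero site of \<open>{- m..m}\<close>; this is that statement for the
  discrete Laplacian. Positive sites follow from \<open>total_diff\<close>, negative ones by
  symmetry.\<close>

lemma total_second_diff:
  assumes "m \<ge> 0"
  shows "2 * total m i - total m (i - 1) - total m (i + 1) =
    (if i = 0 then 2 * m else if \<bar>i\<bar> \<le> m then - 1 else 0)"
proof -
  have pos: "2 * total m j - total m (j - 1) - total m (j + 1) = (if j \<le> m then - 1 else 0)"
    if "j > 0" for j
  proof -
    consider "j < m" | "j = m" | "j > m" by linarith
    then show ?thesis
    proof cases
      case 1
      then show ?thesis
        using total_diff[of j m] total_diff[of "j - 1" m] that by simp
    next
      case 2
      then show ?thesis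
        using total_diff[of "j - 1" m] total_outside[of m j] total_outside[of m "j + 1"] that by simp
    next
      case 3
      then show ?thesis
        using total_outside[of m j] total_outside[of m "j + 1"] total_outside[of m "j - 1"] that
        by simp
    qed
  qed
  consider "i > 0" | "i = 0" | "i < 0" by linarith
  then show ?thesis
  proof cases
    case 1
    then show ?thesis using pos[of i] by simp
  next
    case 2
    then show ?thesis
      using total_diff[of 0 m] total_uminus[of m 1] total_outside[of 0] assms total_outside[of m 1]
        total_outside[of m 0]
      by (cases "m = 0") auto
  next
    case 3
    have "total m (- i - 1) = total m (i + 1)" "total m (- i + 1) = total m (i - 1)"
      using total_uminus[of m "i + 1"] total_uminus[of m "i - 1"] by (simp_all only: minus_add_distrib
        minus_diff_eq diff_conv_add_uminus add.commute minus_minus)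
    then show ?thesis using 3 pos[of "- i"] by simp
  qed
qed

lemma chips_remaining:
  assumes "m \<ge> 0"
  shows "chips m w i = (if i \<noteq> 0 \<and> \<bar>i\<bar> \<le> m then 1 else 0) +
    2 * remaining m w i - remaining m w (i - 1) - remaining m w (i + 1)"
  using total_second_diff[OF assms, of i] by (auto simp: chips_def remaining_def split: if_splits)

lemma legal_nonneg: "legal m w \<Longrightarrow> 0 \<le> w i"
  by (induction arbitrary: i rule: legal.induct) auto

lemma legal_mirror: "legal m w \<Longrightarrow> legal m (\<lambda>i. w (- i))"
proof (induction rule: legal.induct)
  case legal_zero
  show ?case by (rule legal.legal_zero)
next
  case (legal_fire w x)
  have "chips m (\<lambda>i. w (- i)) (- x) = chips m w x"
    by (auto simp: chips_def algebra_simps)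
  moreover have "(\<lambda>i. (w(x := w x + 1)) (- i)) = (\<lambda>i. w (- i))(- x := w (- (- x)) + 1)"
    by (auto simp: fun_eq_iff)
  ultimately show ?case
    using legal.legal_fire[OF legal_fire.IH, of "- x"] legal_fire.hyps by simp
qed

text \<open>A least action principle: if a site has no firings left while its neighbours have
  nonnegative counts, then by \<open>chips_remaining\<close> it holds at most one chip and cannot
  fire.\<close>

lemma legal_remaining_nonneg:
  assumes "m \<ge> 0" "legal m w"
  shows "0 \<le> remaining m w i"
  using assms(2)
proof (induction arbitrary: i rule: legal.induct)
  case legal_zero
  show ?case by (simp add: remaining_def total_nonneg)
next
  case (legal_fire w x)
  have "remaining m w x \<noteq> 0"
    using chips_remaining[OF assms(1), of w x] legal_fire.hyps legal_fire.IH[of "x - 1"]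
      legal_fire.IH[of "x + 1"] by (auto split: if_splits)
  then show ?case
    using legal_fire.IH[of i] legal_fire.IH[of x] by (auto simp: remaining_def)
qed

lemma remaining_outside:
  assumes "m \<ge> 0" "legal m w" "\<bar>i\<bar> \<ge> m"
  shows "remaining m w i = 0"
  using legal_remaining_nonneg[OF assms(1,2), of i] legal_nonneg[OF assms(2), of i]
    total_outside[OF assms(3)] by (simp add: remaining_def)

section \<open>Fired sites and the chips on an interval of them\<close>

text \<open>A site right of the origin starts empty, so its first firing needs chips from a
  neighbour, and by induction the outer neighbour has not fired either.\<close>

lemma fired_pred:
  assumes "legal m w" "i \<ge> 1" "w i > 0"
  shows "w (i - 1) > 0"
  using assms
proof (induction arbitrary: i rule: legal.induct)
  case legal_zero
  then show ?case by simp
next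
  case (legal_fire w x)
  show ?case
  proof (cases "i = x")
    case True
    have "w (x - 1) \<noteq> 0"
    proof
      assume z: "w (x - 1) = 0"
      have "w x = 0"
        using legal_fire.IH[of x] z legal_nonneg[OF legal_fire.hyps(1), of x] True legal_fire.prems
        by force
      moreover from this have "w (x + 1) = 0"
        using legal_fire.IH[of "x + 1"] legal_nonneg[OF legal_fire.hyps(1), of "x + 1"] True
          legal_fire.prems by force
      ultimately show False
        using z legal_fire.hyps(2) True legal_fire.prems by (simp add: chips_def)
    qed
    then show ?thesis
      using True legal_nonneg[OF legal_fire.hyps(1), of "x - 1"] by simp
  next
    case False
    then show ?thesis
      using legal_fire.IH[of i] legal_fire.prems legal_nonneg[OF legal_fire.hyps(1), of x]
      by (auto split: if_splits)
  qed
qed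

lemma fired_downward:
  assumes "legal m w" "w q > 0" "0 \<le> i" "i \<le> q"
  shows "w i > 0"
  using assms(4,3)
proof (induction rule: int_le_induct)
  case base
  show ?case by (rule assms(2))
next
  case (step i)
  then show ?case using fired_pred[OF assms(1), of i] by simp
qed

lemma unfired_succ:
  assumes "legal m w" "w q = 0" "0 \<le> q"
  shows "w (q + 1) = 0"
  using fired_pred[OF assms(1), of "q + 1"] legal_nonneg[OF assms(1), of "q + 1"] assms(2,3) by force

lemma fired_interval_chips:
  assumes "m \<ge> 0" "legal m w" "p \<le> q + 1" "\<forall>i\<in>{p..q}. w i > 0"
  shows "q - p \<le> w (p - 1) - w p + w (q + 1) - w q + (if p \<le> 0 \<and> 0 \<le> q then 2 * m else 0)"
  using assms(2-)
proof (induction arbitrary: p q rule: legal.induct)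
  case legal_zero
  then show ?case using assms(1) by (cases "p \<le> q") auto
next
  case (legal_fire w x)
  show ?case
  proof (cases "x \<in> {p..q}")
    case True
    \<comment> \<open>The two parts leave out \<open>x\<close>, so the induction hypothesis applies
      to them even when this is the first firing of \<open>x\<close>.\<close>
    have l: "x - 1 - p \<le> w (p - 1) - w p + w x - w (x - 1)
        + (if p \<le> 0 \<and> 0 \<le> x - 1 then 2 * m else 0)"
      using legal_fire.IH[of p "x - 1"] legal_fire.prems True by (force split: if_splits)
    have r: "q - (x + 1) \<le> w x - w (x + 1) + w (q + 1) - w q
        + (if x + 1 \<le> 0 \<and> 0 \<le> q then 2 * m else 0)"
      using legal_fire.IH[of "x + 1" q] legal_fire.prems True by (force split: if_splits)
    show ?thesis
      using l r legal_fire.hyps(2) True unfolding chips_def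
      by (cases "p = x"; cases "q = x"; auto split: if_splits)
  next
    case False
    have "q - p \<le> w (p - 1) - w p + w (q + 1) - w q + (if p \<le> 0 \<and> 0 \<le> q then 2 * m else 0)"
      using legal_fire.IH[of p q] legal_fire.prems False by (force split: if_splits)
    then show ?thesis using False legal_fire.prems by auto
  qed
qed

section \<open>Remaining firings at neighbouring sites\<close>

text \<open>A drop of at least two forces a drop of at least one at every later site before
  \<open>m\<close>: by \<open>fired_interval_chips\<close> if the site has fired, and by
  \<open>total_diff\<close> if it and its outer neighbour have not. Summing these drops inward from
  \<open>m\<close> gives the bound.\<close>

lemma remaining_drop:
  assumes m: "m \<ge> 0" and w: "legal m w" and "0 \<le> i"
    and drop: "remaining m w i - remaining m w (i + 1) \<ge> 2"
  shows "remaining m w (i + 1) \<ge> m - i - 1"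
proof (cases "i + 1 \<le> m")
  case False
  then show ?thesis using legal_remaining_nonneg[OF m w, of "i + 1"] by simp
next
  case True
  have d: "remaining m w q - remaining m w (q + 1) \<ge> 1" if q: "i < q" "q < m" for q
  proof (cases "w q = 0")
    case True
    then show ?thesis
      using unfired_succ[OF w, of q] total_diff[of q m] q \<open>0 \<le> i\<close> by (simp add: remaining_def)
  next
    case False
    then have "w q > 0" using legal_nonneg[OF w, of q] by simp
    then have "\<forall>j\<in>{i + 1..q}. w j > 0"
      using fired_downward[OF w] \<open>0 \<le> i\<close> by auto
    then have "q - (i + 1) \<le> w i - w (i + 1) + w (q + 1) - w q"
      using fired_interval_chips[OF m w, of "i + 1" q] q \<open>0 \<le> i\<close> by simp
    then show ?thesis
      using drop total_diff[of q m] total_diff[of i m] q \<open>0 \<le> i\<close> by (simp add: remaining_def)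
  qed
  have "i + 1 \<le> q \<longrightarrow> remaining m w q \<ge> m - q" if "q \<le> m" for q
    using that
  proof (induction rule: int_le_induct)
    case base
    show ?case using legal_remaining_nonneg[OF m w, of m] by simp
  next
    case (step q)
    then show ?case using d[of "q - 1"] by auto
  qed
  then show ?thesis using True by force
qed

text \<open>The rise makes the count nondecreasing on \<open>{0..q}\<close>, so it suffices to bound
  it at \<open>0\<close>. On the negative side, intervals across the origin, with their
  \<open>2 * m\<close> initial chips, force a drop of at least one at each step outward.\<close>

lemma remaining_rise:
  assumes m: "m \<ge> 0" and w: "legal m w" and "0 \<le> q"
    and rise: "remaining m w q < remaining m w (q + 1)"
  shows "remaining m w q \<ge> m"
proof -
  have "q < m"
    using rise remaining_outside[OF m w, of q] remaining_outside[OF m w, of "q + 1"] \<open>0 \<le> q\<close>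
    by force
  have "w q \<noteq> 0"
    using rise unfired_succ[OF w, of q] total_diff[of q m] \<open>0 \<le> q\<close> \<open>q < m\<close>
    by (auto simp: remaining_def)
  then have q: "w q > 0" using legal_nonneg[OF w, of q] by simp
  have right: "remaining m w p \<le> remaining m w (p + 1)" if p: "0 \<le> p" "p < q" for p
  proof -
    have "\<forall>j\<in>{p + 1..q}. w j > 0"
      using fired_downward[OF w q] p by auto
    then have "q - (p + 1) \<le> w p - w (p + 1) + w (q + 1) - w q"
      using fired_interval_chips[OF m w, of "p + 1" q] p by simp
    then show ?thesis
      using rise total_diff[of q m] total_diff[of p m] p \<open>q < m\<close> by (simp add: remaining_def)
  qed
  have "0 \<le> p \<longrightarrow> remaining m w p \<le> remaining m w q" if "p \<le> q" for p
    using that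
  proof (induction rule: int_le_induct)
    case (step p)
    then show ?case using right[of "p - 1"] by auto
  qed simp
  then have 1: "remaining m w 0 \<le> remaining m w q" using \<open>0 \<le> q\<close> by simp
  have left: "remaining m w (- p) - remaining m w (- (p + 1)) \<ge> 1" if p: "0 \<le> p" "p < m" for p
  proof (cases "w (- p) = 0")
    case True
    then show ?thesis
      using unfired_succ[OF legal_mirror[OF w], of p] total_diff[of p m] p
      by (simp add: remaining_def del: minus_add_distrib)
  next
    case False
    then have "w (- p) > 0" using legal_nonneg[OF w, of "- p"] by simp
    then have "w (- j) > 0" if "0 \<le> j" "j \<le> p" for j
      using fired_downward[OF legal_mirror[OF w], of p j] that by simp
    from this[of "- j" for j] have "\<forall>j\<in>{- p..q}. w j > 0"
      using fired_downward[OF w q] by (metis atLeastAtMost_iff linorder_linear minus_le_iff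
        neg_0_le_iff_le minus_minus)
    then have "q + p \<le> w (- p - 1) - w (- p) + w (q + 1) - w q + 2 * m"
      using fired_interval_chips[OF m w, of "- p" q] p \<open>0 \<le> q\<close> by simp
    moreover have "- p - 1 = - (p + 1)" by simp
    ultimately show ?thesis
      using rise total_diff[of q m] total_diff[of p m] p \<open>0 \<le> q\<close> \<open>q < m\<close>
      by (simp add: remaining_def del: minus_add_distrib)
  qed
  have "0 \<le> p \<longrightarrow> remaining m w (- p) \<ge> m - p" if "p \<le> m" for p
    using that
  proof (induction rule: int_le_induct)
    case base
    show ?case using legal_remaining_nonneg[OF m w] by simp
  next
    case (step p)
    then show ?case using left[of "p - 1"] by auto
  qed
  from this[of 0] show ?thesis using 1 m by simp
qed

lemma remaining_mirror: "remaining m (\<lambda>i. w (- i)) i = remaining m w (- i)"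
  by (simp add: remaining_def)

lemma remaining_drop_left:
  assumes "m \<ge> 0" "legal m w" "i \<le> 0" "remaining m w i - remaining m w (i - 1) \<ge> 2"
  shows "remaining m w (i - 1) \<ge> m + i - 1"
proof -
  have "- (- i + 1) = i - 1" by simp
  then show ?thesis
    using remaining_drop[OF assms(1) legal_mirror[OF assms(2)], of "- i"] assms(3,4)
    by (simp add: remaining_mirror del: minus_add_distrib)
qed

lemma remaining_rise_left:
  assumes "m \<ge> 0" "legal m w" "i \<le> 0" "remaining m w i < remaining m w (i - 1)"
  shows "remaining m w i \<ge> m"
proof -
  have "- (- i + 1) = i - 1" by simp
  then show ?thesis
    using remaining_rise[OF assms(1) legal_mirror[OF assms(2)], of "- i"] assms(3,4)
    by (simp add: remaining_mirror del: minus_add_distrib)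
qed

text \<open>The drop lemmas exclude an outward drop of two or more at \<open>x\<close>, and the rise
  lemmas exclude an outward rise into \<open>x\<close>. The resulting lower bounds on both
  neighbours allow at most two chips, so two chips force equality throughout. This is the
  interlacing of the last firings.\<close>

lemma late_firing:
  assumes m: "m \<ge> 0" and w: "legal m w" and "chips m w x \<ge> 2" and "remaining m w x \<le> m - \<bar>x\<bar>"
  shows "chips m w x = 2"
    and "remaining m w (x + 1) = (if x \<ge> 0 then remaining m w x - 1 else remaining m w x)"
proof -
  have r: "remaining m w (x + 1) \<ge> (if x \<ge> 0 then remaining m w x - 1 else remaining m w x)"
    using remaining_drop[OF m w, of x] remaining_rise_left[OF m w, of "x + 1"] assms(4)
    by (cases "x \<ge> 0"; cases "remaining m w x - remaining m w (x + 1) \<ge> 2";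
        cases "remaining m w (x + 1) < remaining m w x"; simp)
  have l: "remaining m w (x - 1) \<ge> (if x > 0 then remaining m w x else remaining m w x - 1)"
    using remaining_drop_left[OF m w, of x] remaining_rise[OF m w, of "x - 1"] assms(4)
    by (cases "x > 0"; cases "remaining m w x - remaining m w (x - 1) \<ge> 2";
        cases "remaining m w (x - 1) < remaining m w x"; simp)
  have c: "chips m w x = (if x \<noteq> 0 \<and> \<bar>x\<bar> \<le> m then 1 else 0) +
    2 * remaining m w x - remaining m w (x - 1) - remaining m w (x + 1)"
    by (rule chips_remaining[OF m])
  show "chips m w x = 2"
    using r l c assms(3) by (auto split: if_splits)
  show "remaining m w (x + 1) = (if x \<ge> 0 then remaining m w x - 1 else remaining m w x)"
    using r l c assms(3) by (auto split: if_splits)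
qed

section \<open>Labeled firing and the positions of the smallest labels\<close>

inductive run :: "('a::linorder) set \<Rightarrow> ('a \<Rightarrow> int) \<Rightarrow> (int \<Rightarrow> int) \<Rightarrow> bool" for L where
  run_init: "run L (\<lambda>_. 0) (\<lambda>_. 0)"
| run_fire: "run L C w \<Longrightarrow> a \<in> L \<Longrightarrow> b \<in> L \<Longrightarrow> a < b \<Longrightarrow> C a = C b \<Longrightarrow>
    run L (C(a := C a - 1, b := C b + 1)) (w(C a := w (C a) + 1))"

lemma sum_upd2:
  fixes f g :: "'a \<Rightarrow> int"
  assumes "finite L" "a \<in> L" "b \<in> L" "a \<noteq> b" "\<And>x. x \<noteq> a \<Longrightarrow> x \<noteq> b \<Longrightarrow> g x = f x"
  shows "sum g L = sum f L - f a - f b + g a + g b"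
proof -
  have "sum h L = h a + h b + sum h (L - {a, b})" for h :: "'a \<Rightarrow> int"
    using assms(1-4) sum.subset_diff[of "{a, b}" L h] by simp
  moreover have "sum g (L - {a, b}) = sum f (L - {a, b})"
    by (rule sum.cong) (auto simp: assms(5))
  ultimately show ?thesis by simp
qed

lemma card_filter_eq_sum: "finite L \<Longrightarrow> int (card {x\<in>L. P x}) = (\<Sum>x\<in>L. of_bool (P x))"
  by (simp add: of_bool_def sum.inter_filter[symmetric])

lemma run_card:
  assumes "finite L" "card L = 2 * m" "run L C w"
  shows "int (card {x\<in>L. C x = i}) = chips (int m) w i"
  using assms(3)
proof (induction arbitrary: i rule: run.induct)
  case run_init
  show ?case using assms(2) by (simp add: chips_def)
next
  case (run_fire C w a b)
  let ?C = "C(a := C a - 1, b := C b + 1)"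
  have "(\<Sum>x\<in>L. of_bool (?C x = i)) = (\<Sum>x\<in>L. of_bool (C x = i)) - of_bool (C a = i)
      - of_bool (C b = i) + of_bool (?C a = i) + (of_bool (?C b = i) :: int)"
    using run_fire.hyps by (intro sum_upd2[OF assms(1)]) auto
  then show ?case
    using run_fire.IH[of i] run_fire.hyps
    by (auto simp: card_filter_eq_sum[OF assms(1)] chips_def split: if_splits)
qed

lemma run_fire_chips:
  assumes "finite L" "card L = 2 * m" "run L C w" "a \<in> L" "b \<in> L" "a \<noteq> b" "C a = C b"
  shows "chips (int m) w (C a) \<ge> 2"
proof -
  have "card {a, b} \<le> card {x\<in>L. C x = C a}"
    using assms by (intro card_mono) auto
  then show ?thesis using run_card[OF assms(1-3), of "C a"] \<open>a \<noteq> b\<close> by simp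
qed

lemma run_legal:
  assumes "finite L" "card L = 2 * m" "run L C w"
  shows "legal (int m) w"
  using assms(3)
proof (induction rule: run.induct)
  case run_init
  show ?case by (rule legal_zero)
next
  case (run_fire C w a b)
  then show ?case
    using run_fire_chips[OF assms(1,2), of C w a b] by (intro legal_fire) auto
qed

text \<open>Beyond \<open>m\<close> the site and both its neighbours have no remaining firings, so
  \<open>chips_remaining\<close> leaves no chip there.\<close>

lemma run_bounded:
  assumes "finite L" "card L = 2 * m" "run L C w" "x \<in> L"
  shows "\<bar>C x\<bar> \<le> int m"
proof (rule ccontr)
  assume *: "\<not> \<bar>C x\<bar> \<le> int m"
  note w = run_legal[OF assms(1-3)]
  have "remaining (int m) w (C x) = 0" "remaining (int m) w (C x - 1) = 0"
    "remaining (int m) w (C x + 1) = 0"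
    using * by (auto intro!: remaining_outside w)
  then have "chips (int m) w (C x) = 0"
    using * chips_remaining[of "int m" w "C x"] by simp
  then have "{y\<in>L. C y = C x} = {}"
    using run_card[OF assms(1-3), of "C x"] assms(1) by simp
  then show False using assms(4) by blast
qed

text \<open>\<open>Z\<close> is an initial segment of the labels, and \<open>card Z\<close> is the
  \<open>k\<close> of the overview. A firing at \<open>x\<close> changes the count only at
  \<open>x\<close> and \<open>x + 1\<close>, so these two sites carry the argument.\<close>

lemma run_small_labels:
  assumes fin: "finite L" and L: "card L = 2 * m" and "run L C w"
    and "Z \<subseteq> L" and down: "\<And>x y. x \<in> Z \<Longrightarrow> y \<in> L \<Longrightarrow> y < x \<Longrightarrow> y \<in> Z"
  shows "int (card {z\<in>Z. i \<le> C z}) \<le> max 0 (int (card Z) - int m +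
    min (remaining (int m) w i + max 0 (- i)) (int m - max 0 i))"
  using assms(3)
proof (induction arbitrary: i rule: run.induct)
  case run_init
  show ?case
  proof (cases "i \<le> 0")
    case True
    \<comment> \<open>This makes the minimum equal to \<open>int m\<close>, so the bound becomes the
      trivial \<open>card Z\<close>.\<close>
    have "remaining (int m) (\<lambda>_. 0) i - i \<ge> int m"
    proof (cases "\<bar>i\<bar> < int m")
      case True
      then show ?thesis
        using total_diff[of "- i" "int m"] total_nonneg[of "int m" "- i + 1"] \<open>i \<le> 0\<close>
        by (simp add: remaining_def)
    next
      case False
      then show ?thesis
        using total_outside[of "int m" i] \<open>i \<le> 0\<close> by (simp add: remaining_def)
    qed
    then show ?thesis using True by simp
  next
    case False
    then show ?thesis by simp
  qed
next
  case (run_fire C w a b)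
  let ?C = "C(a := C a - 1, b := C b + 1)"
  let ?x = "C a"
  let ?w = "w(?x := w ?x + 1)"
  let ?k = "int (card Z)"
  let ?v = "remaining (int m) w"
  let ?A = "\<lambda>C i. int (card {z\<in>Z. i \<le> C z})"
  have finZ: "finite Z" using \<open>Z \<subseteq> L\<close> fin finite_subset by blast
  note w = run_legal[OF fin L run_fire.hyps(1)]
  have ge2: "chips (int m) w ?x \<ge> 2"
    using run_fire_chips[OF fin L run_fire.hyps(1)] run_fire.hyps by simp
  have v': "remaining (int m) ?w i = ?v i - of_bool (i = ?x)" for i
    by (simp add: remaining_def)
  have ab: "a \<noteq> b" "C b = C a" using run_fire.hyps by auto
  have upd: "?A ?C i = ?A C i - of_bool (a \<in> Z \<and> i = ?x) + of_bool (b \<in> Z \<and> i = ?x + 1)" for i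
  proof -
    have eq: "?A D i = (\<Sum>x\<in>L. of_bool (x \<in> Z \<and> i \<le> D x))" for D :: "_ \<Rightarrow> int"
    proof -
      have "{z\<in>Z. i \<le> D z} = {x\<in>L. x \<in> Z \<and> i \<le> D x}" using \<open>Z \<subseteq> L\<close> by auto
      then show ?thesis by (simp add: card_filter_eq_sum[OF fin])
    qed
    have "(\<Sum>x\<in>L. of_bool (x \<in> Z \<and> i \<le> ?C x)) = (\<Sum>x\<in>L. of_bool (x \<in> Z \<and> i \<le> C x))
        - of_bool (a \<in> Z \<and> i \<le> C a) - of_bool (b \<in> Z \<and> i \<le> C b)
        + of_bool (a \<in> Z \<and> i \<le> ?C a) + (of_bool (b \<in> Z \<and> i \<le> ?C b) :: int)"
      using run_fire.hyps by (intro sum_upd2[OF fin]) auto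
    then show ?thesis
      unfolding eq using ab by (auto simp: of_bool_def)
  qed
  have ba: "b \<in> Z \<Longrightarrow> a \<in> Z" using down run_fire.hyps by blast
  consider "i \<noteq> ?x" "i \<noteq> ?x + 1" | "i = ?x + 1" | "i = ?x" by blast
  then show ?case
  proof cases
    case 1
    then show ?thesis using run_fire.IH[of i] unfolding upd v' by simp
  next
    case 2
    show ?thesis
    proof (cases "b \<in> Z")
      case False
      then show ?thesis using run_fire.IH[of i] 2 unfolding upd v' by simp
    next
      case True
      \<comment> \<open>Both fired chips lie in \<open>Z\<close>, so the new count at
        \<open>?x + 1\<close> is at most the old count at \<open>?x\<close> minus one.\<close>
      have "?A C (?x + 1) + 2 \<le> ?A C ?x"
      proof -
        have "card ({z\<in>Z. ?x + 1 \<le> C z} \<union> {a, b}) \<le> card {z\<in>Z. ?x \<le> C z}"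
          using finZ True ba ab by (intro card_mono) auto
        moreover have "card ({z\<in>Z. ?x + 1 \<le> C z} \<union> {a, b}) = card {z\<in>Z. ?x + 1 \<le> C z} + 2"
          using finZ ab by (subst card_Un_disjoint) auto
        ultimately show ?thesis by simp
      qed
      moreover have "?A ?C (?x + 1) = ?A C (?x + 1) + 1"
        using True unfolding upd by simp
      \<comment> \<open>In either alternative the bound at \<open>?x + 1\<close> is at most one
        below the bound at \<open>?x\<close>; in the second, the minimum there is the cap
        \<open>int m - max 0 (?x + 1)\<close>.\<close>
      moreover have "?v (?x + 1) \<ge> ?v ?x - 1 \<or> ?v (?x + 1) \<ge> int m - ?x - 1" if "?x \<ge> 0"
        using remaining_drop[OF _ w that] by linarith
      moreover have "?v ?x \<le> ?v (?x + 1) \<or> ?v (?x + 1) \<ge> int m" if "?x < 0"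
        using remaining_rise_left[OF _ w, of "?x + 1"] that
        by (cases "?v (?x + 1) < ?v ?x") auto
      ultimately show ?thesis
        using run_fire.IH[of ?x] 2 unfolding v' by (cases "?x \<ge> 0") auto
    qed
  next
    case 3
    show ?thesis
    proof (cases "?v ?x \<le> int m - \<bar>?x\<bar>")
      \<comment> \<open>For an early firing the cap \<open>int m - max 0 i\<close> attains the
        minimum before and after, so the bound stays put while the count does not grow.\<close>
      case False
      then show ?thesis using run_fire.IH[of i] 3 unfolding upd v' by (auto split: if_splits)
    next
      case late: True
      show ?thesis
      proof (cases "a \<in> Z")
        case True
        \<comment> \<open>A positive count makes the old bound positive, so both sides can be
          lowered by one despite the outer \<open>max 0\<close>.\<close>
        have "{z\<in>Z. ?x \<le> C z} \<noteq> {}" using True by auto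
        then have "?A C ?x \<ge> 1" using finZ by (simp add: Suc_le_eq card_gt_0_iff)
        then show ?thesis using run_fire.IH[of i] 3 True unfolding upd v' by (auto split: if_splits)
      next
        case False
        \<comment> \<open>Only \<open>a\<close> and \<open>b\<close> are at \<open>?x\<close>, and
          neither is in \<open>Z\<close>, so the counts at \<open>?x\<close> and
          \<open>?x + 1\<close> agree. By \<open>late_firing\<close> the bound at
          \<open>?x + 1\<close> is at most the new bound at \<open>?x\<close>.\<close>
        have "card {x\<in>L. C x = ?x} = 2"
          using late_firing(1)[OF _ w ge2 late] run_card[OF fin L run_fire.hyps(1), of ?x] by simp
        then have "{a, b} = {x\<in>L. C x = ?x}"
          using fin run_fire.hyps by (intro card_subset_eq) auto
        then have "{z\<in>Z. ?x \<le> C z} = {z\<in>Z. ?x + 1 \<le> C z}"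
          using False ba \<open>Z \<subseteq> L\<close> by (force simp: order_le_less zless_imp_add1_zle)
        then have "?A ?C ?x = ?A C (?x + 1)" using False unfolding upd by simp
        then show ?thesis
          using run_fire.IH[of "?x + 1"] late_firing(2)[OF _ w ge2 late] 3 unfolding v'
          by (auto split: if_splits)
      qed
    qed
  qed
qed

section \<open>Settled states of the unlabeled process\<close>

text \<open>The remaining firings of a settled configuration form a convex function that vanishes outside
  \<open>{- m..m}\<close>.\<close>

lemma settled_remaining:
  assumes "m \<ge> 0" "legal m w" "\<And>i. chips m w i \<le> (if i = 0 then 0 else 1)"
  shows "remaining m w i = 0"
proof (cases "\<bar>i\<bar> \<le> m")
  case False
  then show ?thesis using remaining_outside[OF assms(1,2), of i] by simp
next
  case True
  have convex: "2 * remaining m w j \<le> remaining m w (j - 1) + remaining m w (j + 1)"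
    if "\<bar>j\<bar> \<le> m" for j
    using chips_remaining[OF assms(1), of w j] assms(3)[of j] that by (auto split: if_splits)
  have mono: "j \<le> m \<longrightarrow> remaining m w j \<le> remaining m w (j + 1)" if "- m - 1 \<le> j" for j
    using that
  proof (induction rule: int_ge_induct)
    case base
    show ?case
      using remaining_outside[OF assms(1,2), of "- m - 1"] remaining_outside[OF assms(1,2), of "- m"]
        assms(1) by simp
  next
    case (step j)
    then show ?case using convex[of "j + 1"] by (auto simp: abs_le_iff add.assoc)
  qed
  have "- m \<le> j \<longrightarrow> remaining m w j \<le> remaining m w m" if "j \<le> m" for j
    using that
  proof (induction rule: int_le_induct)
    case (step j)
    then show ?case using mono[of "j - 1"] by auto
  qed simp
  from this[of i] show ?thesis
    using True remaining_outside[OF assms(1,2), of m] legal_remaining_nonneg[OF assms(1,2), of i]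
      assms(1) by simp
qed

section \<open>Doubling the chips by reflection\<close>

definition signed_config :: "config \<Rightarrow> int \<Rightarrow> int" where
  "signed_config c a = (if a > 0 then c (nat a) else - c (nat (- a)))"

definition signed_labels :: "nat \<Rightarrow> int set" where
  "signed_labels n = {- int n..int n} - {0}"

lemma finite_signed_labels: "finite (signed_labels n)"
  by (simp add: signed_labels_def)

lemma card_signed_labels: "card (signed_labels n) = 2 * n"
  by (simp add: signed_labels_def)

text \<open>Move I fires \<open>(a, b)\<close> and then \<open>(- b, - a)\<close> at the mirror
  site; move II fires \<open>(- b, a)\<close> and then \<open>(- a, b)\<close>; move III is the
  single firing \<open>(- a, a)\<close>. The two pairs share no label, so the second is still
  together after the first has fired.\<close>

lemma run_signed_config_move:
  assumes "move n c c'" "\<exists>w. run (signed_labels n) (signed_config c) w"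
  shows "\<exists>w. run (signed_labels n) (signed_config c') w"
proof -
  obtain w where w: "run (signed_labels n) (signed_config c) w" using assms(2) by blast
  show ?thesis
    using assms(1)
  proof cases
    case (move_I a b)
    let ?D = "(signed_config c)(int a := signed_config c (int a) - 1,
      int b := signed_config c (int b) + 1)"
    let ?E = "?D(- int b := ?D (- int b) - 1, - int a := ?D (- int a) + 1)"
    have "\<exists>w. run (signed_labels n) ?D w"
      using run_fire[OF w, of "int a" "int b"] move_I
      by (auto simp: signed_labels_def signed_config_def)
    then have "\<exists>w. run (signed_labels n) ?E w"
      using run_fire[of "signed_labels n" ?D _ "- int b" "- int a"] move_I
      by (auto simp: signed_labels_def signed_config_def)
    moreover have "signed_config c' = ?E"
      using move_I by (auto simp: signed_config_def fun_eq_iff)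
    ultimately show ?thesis by simp
  next
    case (move_II a b)
    let ?D = "(signed_config c)(- int b := signed_config c (- int b) - 1,
      int a := signed_config c (int a) + 1)"
    let ?E = "?D(- int a := ?D (- int a) - 1, int b := ?D (int b) + 1)"
    have "\<exists>w. run (signed_labels n) ?D w"
      using run_fire[OF w, of "- int b" "int a"] move_II
      by (auto simp: signed_labels_def signed_config_def)
    then have "\<exists>w. run (signed_labels n) ?E w"
      using run_fire[of "signed_labels n" ?D _ "- int a" "int b"] move_II
      by (auto simp: signed_labels_def signed_config_def)
    moreover have "signed_config c' = ?E"
      using move_II by (auto simp: signed_config_def fun_eq_iff)
    ultimately show ?thesis by simp
  next
    case (move_III a)
    let ?D = "(signed_config c)(- int a := signed_config c (- int a) - 1,
      int a := signed_config c (int a) + 1)"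
    have "\<exists>w. run (signed_labels n) ?D w"
      using run_fire[OF w, of "- int a" "int a"] move_III
      by (auto simp: signed_labels_def signed_config_def)
    moreover have "signed_config c' = ?D"
      using move_III by (auto simp: signed_config_def fun_eq_iff)
    ultimately show ?thesis by simp
  qed
qed

lemma run_signed_config_reachable:
  assumes "(move n)\<^sup>*\<^sup>* initial_config c"
  shows "\<exists>w. run (signed_labels n) (signed_config c) w"
  using assms
proof (induction rule: rtranclp_induct)
  case base
  have "signed_config initial_config = (\<lambda>_. 0)"
    by (auto simp: signed_config_def initial_config_def)
  then show ?case using run_init[of "signed_labels n"] by auto
next
  case (step c c')
  then show ?case using run_signed_config_move by blast
qed

section \<open>Termination through bounded positions and a growing sum of squares\<close>

lemma reachable_bounded:
  assumes "(move n)\<^sup>*\<^sup>* initial_config c" "a \<in> {1..n}"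
  shows "\<bar>c a\<bar> \<le> int n"
proof -
  obtain w where "run (signed_labels n) (signed_config c) w"
    using run_signed_config_reachable[OF assms(1)] by blast
  from run_bounded[OF finite_signed_labels card_signed_labels this, of "int a"] show ?thesis
    using assms(2) by (simp add: signed_labels_def signed_config_def)
qed

text \<open>Moves I and II add \<open>2\<close> to the sum, since the linear terms cancel; move III
  adds \<open>1\<close>.\<close>

lemma move_sum_squares:
  assumes "move n c c'"
  shows "(\<Sum>a\<in>{1..n}. (c a)\<^sup>2) < (\<Sum>a\<in>{1..n}. (c' a)\<^sup>2)"
  using assms
proof cases
  case (move_I a b)
  then have "(\<Sum>a\<in>{1..n}. (c' a)\<^sup>2) = (\<Sum>a\<in>{1..n}. (c a)\<^sup>2)
      - (c a)\<^sup>2 - (c b)\<^sup>2 + (c' a)\<^sup>2 + (c' b)\<^sup>2"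
    by (intro sum_upd2) auto
  then show ?thesis using move_I by (simp add: power2_eq_square algebra_simps)
next
  case (move_II a b)
  then have "(\<Sum>a\<in>{1..n}. (c' a)\<^sup>2) = (\<Sum>a\<in>{1..n}. (c a)\<^sup>2)
      - (c a)\<^sup>2 - (c b)\<^sup>2 + (c' a)\<^sup>2 + (c' b)\<^sup>2"
    by (intro sum_upd2) auto
  then show ?thesis using move_II by (simp add: power2_eq_square algebra_simps)
next
  case (move_III a)
  then show ?thesis
    by (intro sum_strict_mono_ex1) auto
qed

section \<open>Terminal configurations\<close>

lemma terminal_nonzero:
  assumes "terminal n c" "a \<in> {1..n}"
  shows "c a \<noteq> 0"
  using assms move_III[of a n c] unfolding terminal_def by blast

lemma terminal_distinct:
  assumes "terminal n c" "a \<in> {1..n}" "b \<in> {1..n}" "a \<noteq> b"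
  shows "\<bar>c a\<bar> \<noteq> \<bar>c b\<bar>"
proof
  assume "\<bar>c a\<bar> = \<bar>c b\<bar>"
  then consider "c a = c b" | "c b = - c a" by linarith
  then show False
  proof cases
    case 1
    then show False
      using assms move_I[of a n b c] move_I[of b n a c] unfolding terminal_def
      by (metis nat_neq_iff)
  next
    case 2
    then show False
      using assms move_II[of a n b c] unfolding terminal_def by blast
  qed
qed

text \<open>In a terminal configuration the signed chips occupy distinct nonzero sites, so no
  firings remain. Then \<open>run_small_labels\<close> bounds the position of \<open>- int a\<close>
  from above, which reflects to a lower bound for \<open>a\<close>.\<close>

lemma terminal_lower_bound:
  assumes reach: "(move n)\<^sup>*\<^sup>* initial_config c" and stop: "terminal n c" and a: "a \<in> {1..n}"
  shows "int a \<le> c a"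
proof -
  obtain w where w: "run (signed_labels n) (signed_config c) w"
    using run_signed_config_reachable[OF reach] by blast
  have inj: "inj_on (signed_config c) (signed_labels n)"
  proof (rule inj_onI)
    fix x y assume x: "x \<in> signed_labels n" and y: "y \<in> signed_labels n"
      and eq: "signed_config c x = signed_config c y"
    have abs: "nat \<bar>x\<bar> \<in> {1..n}" "nat \<bar>y\<bar> \<in> {1..n}"
      using x y by (auto simp: signed_labels_def)
    have "\<bar>signed_config c z\<bar> = \<bar>c (nat \<bar>z\<bar>)\<bar>" for z
      by (simp add: signed_config_def)
    then have "nat \<bar>x\<bar> = nat \<bar>y\<bar>"
      using eq terminal_distinct[OF stop abs] by metis
    then show "x = y"
      using eq terminal_nonzero[OF stop abs(1)] x y
      by (auto simp: signed_config_def signed_labels_def abs_if split: if_splits)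
  qed
  have nonzero: "signed_config c x \<noteq> 0" if "x \<in> signed_labels n" for x
  proof -
    have "nat \<bar>x\<bar> \<in> {1..n}" using that by (auto simp: signed_labels_def)
    then show ?thesis
      using terminal_nonzero[OF stop, of "nat \<bar>x\<bar>"] by (auto simp: signed_config_def split: if_splits)
  qed
  have "chips (int n) w i \<le> (if i = 0 then 0 else 1)" for i
  proof -
    have "card {x\<in>signed_labels n. signed_config c x = i} \<le> (if i = 0 then 0 else 1)"
    proof (cases "i = 0")
      case True
      have "{x\<in>signed_labels n. signed_config c x = 0} = {}" using nonzero by blast
      then have "card {x\<in>signed_labels n. signed_config c x = 0} = 0" by (simp only: card.empty)
      then show ?thesis using True by simp
    next
      case False
      have "\<forall>x\<in>{x\<in>signed_labels n. signed_config c x = i}.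
          \<forall>y\<in>{x\<in>signed_labels n. signed_config c x = i}. x = y"
        using inj by (auto simp: inj_on_def)
      then show ?thesis using False by (simp add: card_le_Suc0_iff_eq finite_signed_labels)
    qed
    then show ?thesis
      using run_card[OF finite_signed_labels card_signed_labels w, of i] by (auto split: if_splits)
  qed
  then have v: "remaining (int n) w i = 0" for i
    using settled_remaining run_legal[OF finite_signed_labels card_signed_labels w] by simp
  \<comment> \<open>As \<open>card ?Z = n - a + 1\<close>, the site \<open>1 - int a\<close> is
    \<open>k - m\<close> in the overview; there the minimum is \<open>int a - 1\<close> and the
    whole bound is \<open>0\<close>.\<close>
  let ?Z = "{- int n..- int a}"
  have "int (card {z\<in>?Z. 1 - int a \<le> signed_config c z}) \<le> max 0 (int (card ?Z) - int n +
    min (remaining (int n) w (1 - int a) + max 0 (- (1 - int a))) (int n - max 0 (1 - int a)))"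
    by (rule run_small_labels[OF finite_signed_labels card_signed_labels w])
      (use a in \<open>auto simp: signed_labels_def\<close>)
  then have "card {z\<in>?Z. 1 - int a \<le> signed_config c z} = 0"
    using a by (simp add: v)
  then have "{z\<in>?Z. 1 - int a \<le> signed_config c z} = {}"
    by (subst (asm) card_0_eq) (rule finite_subset[of _ ?Z], auto)
  then have "\<not> 1 - int a \<le> signed_config c (- int a)" using a by auto
  then show ?thesis using a by (simp add: signed_config_def)
qed

theorem theorem3p11:
  fixes n :: nat
  assumes "n \<ge> 1"
  shows "(\<nexists>s :: nat \<Rightarrow> config. s 0 = initial_config \<and> (\<forall>k. move n (s k) (s (Suc k)))) \<and>
    (\<forall>c. (move n)\<^sup>*\<^sup>* initial_config c \<longrightarrow> terminal n c \<longrightarrow> (\<forall>i\<in>{1..n}. c i = int i))"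
proof (intro conjI allI impI ballI notI)
  assume "\<exists>s. s 0 = initial_config \<and> (\<forall>k. move n (s k) (s (Suc k)))"
  then obtain s where s: "s 0 = initial_config" "\<And>k. move n (s k) (s (Suc k))" by blast
  have reach: "(move n)\<^sup>*\<^sup>* initial_config (s k)" for k
    by (induction k) (auto simp: s intro: rtranclp.rtrancl_into_rtrancl)
  let ?q = "\<lambda>k. \<Sum>a\<in>{1..n}. (s k a)\<^sup>2"
  have lower: "int k \<le> ?q k" for k
  proof (induction k)
    case 0
    show ?case by (simp add: sum_nonneg)
  next
    case (Suc k)
    then show ?case using move_sum_squares[OF s(2)[of k]] by simp
  qed
  have upper: "?q k \<le> int n * (int n)\<^sup>2" for k
  proof -
    have "(s k a)\<^sup>2 \<le> (int n)\<^sup>2" if "a \<in> {1..n}" for a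
      using reachable_bounded[OF reach that] abs_le_square_iff[of "s k a" "int n"] by simp
    from sum_bounded_above[of "{1..n}", OF this] show ?thesis by simp
  qed
  show False
    using lower[of "Suc (n * n\<^sup>2)"] upper[of "Suc (n * n\<^sup>2)"] by simp
next
  fix c i
  assume reach: "(move n)\<^sup>*\<^sup>* initial_config c" and stop: "terminal n c" and "i \<in> {1..n}"
  show "c i = int i"
    using \<open>i \<in> {1..n}\<close>
  \<comment> \<open>Labels are settled from \<open>n\<close> downward: chip \<open>i\<close> lies in
    \<open>{i..n}\<close>, and every site above \<open>i\<close> there is taken by the chip of that
    label.\<close>
  proof (induction "n - i" arbitrary: i rule: less_induct)
    case less
    have lb: "int i \<le> c i" by (rule terminal_lower_bound[OF reach stop less.prems])
    have ub: "c i \<le> int n" using reachable_bounded[OF reach less.prems] by simp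
    show ?case
    proof (rule ccontr)
      assume "c i \<noteq> int i"
      then have j: "nat (c i) \<in> {1..n}" "i < nat (c i)" using lb ub less.prems by auto
      then have "c (nat (c i)) = c i" using less.hyps[of "nat (c i)"] less.prems lb by auto
      then show False
        using terminal_distinct[OF stop less.prems j(1)] j(2) by simp
    qed
  qed
qed

end
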